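(* Let $(W,H,\mu)$ be an abstract Wiener space and $\omega:W\times W\to\mathbb{R}$ a continuous non-degenerate skew-symmetric bilinear form with $\operatorname{Span}\{\omega(u,v):u,v\in H\}=\mathbb{R}$. Let $G=W\times\mathbb{R}$ be the Heisenberg-like group, $\widetilde{G}=W\times\mathbb{T}^1$ the reduced Heisenberg group, and $\varphi:G\to\widetilde{G}$, $\varphi(w,c)=(w,e^{ci})$, the quotient map. Then for every $f\in\mathcal{FC}^\infty_c(\widetilde{G})$, $$\langle\operatorname{grad}^{\widetilde{G}}_Hf,\operatorname{grad}^{\widetilde{G}}_Hf\rangle_H\circ\varphi=\langle\operatorname{grad}^G_H(f\circ\varphi),\operatorname{grad}^G_H(f\circ\varphi)\rangle_H$$ and $$\left(L_H^{\widetilde{G}}f\right)\circ\varphi=L_H^G(f\circ\varphi).$$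
   Context: Abstract Wiener space: $W$ is a real separable Banach space, $\mu$ a mean-zero non-degenerate Gaussian measure on $W$ with covariance form $q$ on $W^*$, and $H=\{h\in W:\|h\|_H<\infty\}$, $\|h\|_H=\sup_{u\in W^*\setminus\{0\}}|u(h)|/\sqrt{q(u,u)}$, its Cameron–Martin Hilbert space. Groups: $G=W\times\mathbb{R}$ with $(w_1,c_1)\cdot(w_2,c_2)=(w_1+w_2,c_1+c_2+\frac12\omega(w_1,w_2))$ and norm $|(w,c)|_G=\sqrt{\|w\|_W^2+|c|^2}$; $\widetilde{G}=W\times\mathbb{T}^1$ with $(w_1,e^{c_1i})\cdot(w_2,e^{c_2i})=(w_1+w_2,e^{(c_1+c_2+\frac12\omega(w_1,w_2))i})$. For $X=(A,a)\in W\times\mathbb{R}$ the left-invariant vector field $\widetilde{X}$ acts by $(\widetilde{X}f)(g)=\frac{d}{ds}|_{s=0}f(g\cdot(sA,sa))$ on $G$ and by $(\widetilde{X}f)(\widetilde{g})=\frac{d}{ds}|_{s=0}f(\widetilde{g}\cdot(sA,e^{sai}))$ on $\widetilde{G}$. Cylinder functions: $H_*$ is the dense subspace of those $h\in H$ for which $\langle\cdot,h\rangle_H$ extends to an element of $W^*$. $\mathrm{Proj}(W)$ is the set of continuous finite-rank projections $P$ on $W$ with $PW\subset H_*$, $P|_H$ an orthogonal projection of $H$, and $\{\omega(A,B):A,B\in PW\}=\mathbb{R}$. Put $G_P=PW\times\mathbb{R}$, $\widetilde{G}_P=PW\times\mathbb{T}^1$, $\pi_P(w,x)=(Pw,x)$,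 $\widetilde{\pi}_P(w,s)=(Pw,s)$. A smooth cylinder function on $G$ (resp. $\widetilde{G}$) is a real function $F\circ\pi_P$ (resp. $F\circ\widetilde{\pi}_P$) with $P\in\mathrm{Proj}(W)$ and $F$ smooth on $G_P$ (resp. $\widetilde{G}_P$). $\mathcal{FC}^\infty_c(\widetilde{G})$ is the set of $f=F\circ\widetilde{\pi}_P$ with $P\in\mathrm{Proj}(W)$, $F\in C_c^\infty(\widetilde{G}_P)$. $\mathcal{A}$ is the set of smooth cylinder functions $u$ on $G$ such that $u$ and $Xu$, for every left-invariant vector field $X$ on $G$, are polynomially bounded in $|\cdot|_G$. Operators: with $\{e_j\}$ any orthonormal basis of $H$, the sub-Laplacians on smooth cylinder functions are $L_H^Gf=\sum_j\widetilde{(e_j,0)}^2f$ on $G$ and $L_H^{\widetilde{G}}f=\sum_j\widetilde{(e_j,0)}^2f$ on $\widetilde{G}$. The horizontal gradients are the $H$-valued functions determined by $\langle\operatorname{grad}_H^Gu,h\rangle_H=\widetilde{(h,0)}u$ for all $h\in H$ ($u\in\mathcal{A}$) and $\langle\operatorname{grad}_H^{\widetilde{G}}f,h\rangle_H=\widetilde{(h,0)}f$ for all $h\in H$ ($f\in\mathcal{FC}^\infty_c(\widetilde{G})$). *)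

theory Defs
  imports "HOL-Probability.Probability"
begin

section \<open>Abstract Wiener spaces\<close>

text \<open>
  \<open>W\<close> is a type of class \<open>banach\<close> and \<open>second_countable_topology\<close> (i.e. separable); its dual
  is \<open>'w \<Rightarrow>\<^sub>L real\<close>.
\<close>

definition nondegenerate_gaussian :: "'w::{banach, second_countable_topology} measure \<Rightarrow> bool" where
  "nondegenerate_gaussian \<mu> \<longleftrightarrow>
     prob_space \<mu> \<and> sets \<mu> = sets borel \<and>
     (\<forall>u :: 'w \<Rightarrow>\<^sub>L real. u \<noteq> 0 \<longrightarrow>
        (\<exists>\<sigma>>0. distributed \<mu> lborel (blinfun_apply u) (\<lambda>x. ennreal (normal_density 0 \<sigma> x))))"

definition covariance_form ::
    "'w::{banach, second_countable_topology} measure \<Rightarrow> ('w \<Rightarrow>\<^sub>L real) \<Rightarrow> ('w \<Rightarrow>\<^sub>L real) \<Rightarrow> real" where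
  "covariance_form \<mu> u v = (\<integral>x. blinfun_apply u x * blinfun_apply v x \<partial>\<mu>)"

definition cm_enorm :: "'w::{banach, second_countable_topology} measure \<Rightarrow> 'w \<Rightarrow> ennreal" where
  "cm_enorm \<mu> h =
     (SUP u\<in>{u :: 'w \<Rightarrow>\<^sub>L real. u \<noteq> 0}.
        ennreal (\<bar>blinfun_apply u h\<bar> / sqrt (covariance_form \<mu> u u)))"

definition cm_space :: "'w::{banach, second_countable_topology} measure \<Rightarrow> 'w set" where
  "cm_space \<mu> = {h. cm_enorm \<mu> h < \<infinity>}"

definition cm_norm :: "'w::{banach, second_countable_topology} measure \<Rightarrow> 'w \<Rightarrow> real" where
  "cm_norm \<mu> h = enn2real (cm_enorm \<mu> h)"

text \<open>The inner product of the Hilbert space \<open>H\<close> is recovered from its norm by polarization.\<close>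

definition cm_inner :: "'w::{banach, second_countable_topology} measure \<Rightarrow> 'w \<Rightarrow> 'w \<Rightarrow> real" where
  "cm_inner \<mu> h k = ((cm_norm \<mu> (h + k))\<^sup>2 - (cm_norm \<mu> (h - k))\<^sup>2) / 4"

definition cm_onb :: "'w::{banach, second_countable_topology} measure \<Rightarrow> 'w set \<Rightarrow> bool" where
  "cm_onb \<mu> B \<longleftrightarrow>
     B \<subseteq> cm_space \<mu> \<and>
     (\<forall>e\<in>B. \<forall>e'\<in>B. cm_inner \<mu> e e' = (if e = e' then 1 else 0)) \<and>
     (\<forall>h\<in>cm_space \<mu>. \<forall>\<epsilon>>0. \<exists>k\<in>span B. cm_norm \<mu> (h - k) < \<epsilon>)"

definition H_star :: "'w::{banach, second_countable_topology} measure \<Rightarrow> 'w set" where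
  "H_star \<mu> = {h \<in> cm_space \<mu>.
     \<exists>u :: 'w \<Rightarrow>\<^sub>L real. \<forall>k\<in>cm_space \<mu>. blinfun_apply u k = cm_inner \<mu> k h}"


section \<open>The two Heisenberg-like groups\<close>

definition nondegenerate_skew_form :: "('w::real_normed_vector \<Rightarrow> 'w \<Rightarrow> real) \<Rightarrow> bool" where
  "nondegenerate_skew_form \<omega> \<longleftrightarrow>
     bounded_bilinear \<omega> \<and> (\<forall>u v. \<omega> u v = - \<omega> v u) \<and> (\<forall>u. (\<forall>v. \<omega> u v = 0) \<longrightarrow> u = 0)"

definition mult_G ::
    "('w::real_normed_vector \<Rightarrow> 'w \<Rightarrow> real) \<Rightarrow> 'w \<times> real \<Rightarrow> 'w \<times> real \<Rightarrow> 'w \<times> real" where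
  "mult_G \<omega> g g' = (fst g + fst g', snd g + snd g' + \<omega> (fst g) (fst g') / 2)"

text \<open>
  The reduced group is the subset \<open>UNIV \<times> sphere 0 1\<close> of \<open>'w \<times> complex\<close>. Functions on it are
  total functions on \<open>'w \<times> complex\<close> whose values off this subset are irrelevant.
\<close>

definition carrier_Gt :: "('w::real_normed_vector \<times> complex) set" where
  "carrier_Gt = UNIV \<times> sphere 0 1"

definition mult_Gt ::
    "('w::real_normed_vector \<Rightarrow> 'w \<Rightarrow> real) \<Rightarrow> 'w \<times> complex \<Rightarrow> 'w \<times> complex \<Rightarrow> 'w \<times> complex" where
  "mult_Gt \<omega> g g' = (fst g + fst g', snd g * snd g' * cis (\<omega> (fst g) (fst g') / 2))"

definition quotient_map_G :: "'w::real_normed_vector \<times> real \<Rightarrow> 'w \<times> complex" where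
  "quotient_map_G g = (fst g, cis (snd g))"

definition left_inv_G ::
    "('w::real_normed_vector \<Rightarrow> 'w \<Rightarrow> real) \<Rightarrow> 'w \<times> real \<Rightarrow> ('w \<times> real \<Rightarrow> real) \<Rightarrow> 'w \<times> real \<Rightarrow> real" where
  "left_inv_G \<omega> X f g = deriv (\<lambda>s. f (mult_G \<omega> g (s *\<^sub>R fst X, s * snd X))) 0"

definition left_inv_Gt ::
    "('w::real_normed_vector \<Rightarrow> 'w \<Rightarrow> real) \<Rightarrow> 'w \<times> real \<Rightarrow>
       ('w \<times> complex \<Rightarrow> real) \<Rightarrow> 'w \<times> complex \<Rightarrow> real" where
  "left_inv_Gt \<omega> X f g = deriv (\<lambda>s. f (mult_Gt \<omega> g (s *\<^sub>R fst X, cis (s * snd X)))) 0"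


section \<open>Smooth functions on finite-dimensional spaces and submanifolds\<close>

text \<open>
  Here \<open>V\<close> is a finite-dimensional linear subspace and \<open>U\<close> is relatively open in \<open>V\<close>. The values
  \<open>f' x v\<close> with \<open>v \<in> V\<close> are uniquely determined by \<open>f\<close>, so this is the usual notion of \<open>C\<^sup>k\<close>
  function on the open subset \<open>U\<close> of \<open>V\<close>.
\<close>

primrec Ck_on :: "nat \<Rightarrow> 'a::real_normed_vector set \<Rightarrow> 'a set \<Rightarrow> ('a \<Rightarrow> real) \<Rightarrow> bool" where
  "Ck_on 0 V U f \<longleftrightarrow> continuous_on U f"
| "Ck_on (Suc k) V U f \<longleftrightarrow>
     (\<exists>f'. (\<forall>x\<in>U. (f has_derivative f' x) (at x within V)) \<and>
           (\<forall>v\<in>V. Ck_on k V U (\<lambda>x. f' x v)))"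

definition smooth_on :: "'a::real_normed_vector set \<Rightarrow> 'a set \<Rightarrow> ('a \<Rightarrow> real) \<Rightarrow> bool" where
  "smooth_on V U f \<longleftrightarrow> (\<forall>k. Ck_on k V U f)"

text \<open>
  Smoothness on an embedded submanifold \<open>M\<close> of the finite-dimensional space \<open>V\<close>: local
  extendability to smooth functions on open subsets of \<open>V\<close>.
\<close>

definition smooth_on_submanifold ::
    "'a::real_normed_vector set \<Rightarrow> 'a set \<Rightarrow> ('a \<Rightarrow> real) \<Rightarrow> bool" where
  "smooth_on_submanifold V M F \<longleftrightarrow>
     (\<forall>p\<in>M. \<exists>U F'. openin (top_of_set V) U \<and> p \<in> U \<and> smooth_on V U F' \<and>
        (\<forall>x\<in>U \<inter> M. F x = F' x))"


section \<open>Cylinder functions\<close>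

text \<open>
  An orthogonal projection of \<open>H\<close> is an idempotent map that is self-adjoint for the inner
  product of \<open>H\<close>.
\<close>

definition Proj_W ::
    "'w::{banach, second_countable_topology} measure \<Rightarrow> ('w \<Rightarrow> 'w \<Rightarrow> real) \<Rightarrow> ('w \<Rightarrow>\<^sub>L 'w) set" where
  "Proj_W \<mu> \<omega> = {P.
     P o\<^sub>L P = P \<and>
     (\<exists>B. finite B \<and> range (blinfun_apply P) = span B) \<and>
     range (blinfun_apply P) \<subseteq> H_star \<mu> \<and>
     (\<forall>h\<in>cm_space \<mu>. \<forall>k\<in>cm_space \<mu>.
        cm_inner \<mu> (blinfun_apply P h) k = cm_inner \<mu> h (blinfun_apply P k)) \<and>
     {\<omega> A B | A B. A \<in> range (blinfun_apply P) \<and> B \<in> range (blinfun_apply P)} = UNIV}"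

definition G_P :: "('w::real_normed_vector \<Rightarrow>\<^sub>L 'w) \<Rightarrow> ('w \<times> real) set" where
  "G_P P = range (blinfun_apply P) \<times> UNIV"

definition Gt_P :: "('w::real_normed_vector \<Rightarrow>\<^sub>L 'w) \<Rightarrow> ('w \<times> complex) set" where
  "Gt_P P = range (blinfun_apply P) \<times> sphere 0 1"

definition proj_P :: "('w::real_normed_vector \<Rightarrow>\<^sub>L 'w) \<Rightarrow> 'w \<times> 'c \<Rightarrow> 'w \<times> 'c" where
  "proj_P P g = (blinfun_apply P (fst g), snd g)"

definition smooth_Gt_P :: "('w::real_normed_vector \<Rightarrow>\<^sub>L 'w) \<Rightarrow> ('w \<times> complex \<Rightarrow> real) \<Rightarrow> bool" where
  "smooth_Gt_P P F \<longleftrightarrow> smooth_on_submanifold (range (blinfun_apply P) \<times> UNIV) (Gt_P P) F"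

definition cyl_G ::
    "'w::{banach, second_countable_topology} measure \<Rightarrow> ('w \<Rightarrow> 'w \<Rightarrow> real) \<Rightarrow>
       ('w \<times> real \<Rightarrow> real) set" where
  "cyl_G \<mu> \<omega> = {f. \<exists>P\<in>Proj_W \<mu> \<omega>. \<exists>F. smooth_on (G_P P) (G_P P) F \<and> f = F \<circ> proj_P P}"

definition cyl_Gt ::
    "'w::{banach, second_countable_topology} measure \<Rightarrow> ('w \<Rightarrow> 'w \<Rightarrow> real) \<Rightarrow>
       ('w \<times> complex \<Rightarrow> real) set" where
  "cyl_Gt \<mu> \<omega> = {f. \<exists>P\<in>Proj_W \<mu> \<omega>. \<exists>F. smooth_Gt_P P F \<and>
     (\<forall>g\<in>carrier_Gt. f g = F (proj_P P g))}"

definition FC_Gt ::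
    "'w::{banach, second_countable_topology} measure \<Rightarrow> ('w \<Rightarrow> 'w \<Rightarrow> real) \<Rightarrow>
       ('w \<times> complex \<Rightarrow> real) set" where
  "FC_Gt \<mu> \<omega> = {f. \<exists>P\<in>Proj_W \<mu> \<omega>. \<exists>F. smooth_Gt_P P F \<and>
     compact (closure {x \<in> Gt_P P. F x \<noteq> 0}) \<and>
     (\<forall>g\<in>carrier_Gt. f g = F (proj_P P g))}"

text \<open>The norm of the product type \<open>'w \<times> real\<close> is exactly the norm of \<open>G\<close>.\<close>

definition poly_bounded_G :: "('w::real_normed_vector \<times> real \<Rightarrow> real) \<Rightarrow> bool" where
  "poly_bounded_G u \<longleftrightarrow> (\<exists>C. \<exists>N::nat. \<forall>g. \<bar>u g\<bar> \<le> C * (1 + norm g) ^ N)"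

definition class_A ::
    "'w::{banach, second_countable_topology} measure \<Rightarrow> ('w \<Rightarrow> 'w \<Rightarrow> real) \<Rightarrow>
       ('w \<times> real \<Rightarrow> real) set" where
  "class_A \<mu> \<omega> = {u \<in> cyl_G \<mu> \<omega>. poly_bounded_G u \<and> (\<forall>X. poly_bounded_G (left_inv_G \<omega> X u))}"


section \<open>Sub-Laplacians and horizontal gradients\<close>

text \<open>
  Each operator is \<open>undefined\<close> outside its domain. The value of a sub-Laplacian is the common value
  of the (unconditionally convergent) sums over all orthonormal bases of \<open>H\<close>.
\<close>

definition subLaplacian_G ::
    "'w::{banach, second_countable_topology} measure \<Rightarrow> ('w \<Rightarrow> 'w \<Rightarrow> real) \<Rightarrow>
       ('w \<times> real \<Rightarrow> real) \<Rightarrow> 'w \<times> real \<Rightarrow> real" where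
  "subLaplacian_G \<mu> \<omega> f g =
     (if f \<in> cyl_G \<mu> \<omega> then
        THE l. \<forall>B. cm_onb \<mu> B \<longrightarrow>
          ((\<lambda>e. left_inv_G \<omega> (e, 0) (left_inv_G \<omega> (e, 0) f) g) has_sum l) B
      else undefined)"

definition subLaplacian_Gt ::
    "'w::{banach, second_countable_topology} measure \<Rightarrow> ('w \<Rightarrow> 'w \<Rightarrow> real) \<Rightarrow>
       ('w \<times> complex \<Rightarrow> real) \<Rightarrow> 'w \<times> complex \<Rightarrow> real" where
  "subLaplacian_Gt \<mu> \<omega> f g =
     (if f \<in> cyl_Gt \<mu> \<omega> then
        THE l. \<forall>B. cm_onb \<mu> B \<longrightarrow>
          ((\<lambda>e. left_inv_Gt \<omega> (e, 0) (left_inv_Gt \<omega> (e, 0) f) g) has_sum l) B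
      else undefined)"

definition grad_G ::
    "'w::{banach, second_countable_topology} measure \<Rightarrow> ('w \<Rightarrow> 'w \<Rightarrow> real) \<Rightarrow>
       ('w \<times> real \<Rightarrow> real) \<Rightarrow> 'w \<times> real \<Rightarrow> 'w" where
  "grad_G \<mu> \<omega> u g =
     (if u \<in> class_A \<mu> \<omega> then
        THE v. v \<in> cm_space \<mu> \<and> (\<forall>h\<in>cm_space \<mu>. cm_inner \<mu> v h = left_inv_G \<omega> (h, 0) u g)
      else undefined)"

definition grad_Gt ::
    "'w::{banach, second_countable_topology} measure \<Rightarrow> ('w \<Rightarrow> 'w \<Rightarrow> real) \<Rightarrow>
       ('w \<times> complex \<Rightarrow> real) \<Rightarrow> 'w \<times> complex \<Rightarrow> 'w" where
  "grad_Gt \<mu> \<omega> f g =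
     (if f \<in> FC_Gt \<mu> \<omega> then
        THE v. v \<in> cm_space \<mu> \<and> (\<forall>h\<in>cm_space \<mu>. cm_inner \<mu> v h = left_inv_Gt \<omega> (h, 0) f g)
      else undefined)"

end

theory Submission
  imports Defs
begin

text \<open>
  The quotient map is a group homomorphism that carries \<open>(sA, sa)\<close> to \<open>(sA, cis (sa))\<close>, so it
  intertwines the left-invariant derivatives pointwise, and with them the defining conditions of
  gradients and sub-Laplacians. What remains is that \<open>f \<circ> quotient_map_G\<close> lies in the domains of
  the operators on \<open>G\<close>: it is smooth by the chain rule, and it and its partial derivatives are
  bounded, being periodic in the centre and compactly supported modulo the period. The coefficients
  of the left-invariant vector fields in these partial derivatives grow at most linearly.
\<close>

section \<open>Calculus of \<open>C\<^sup>k\<close> functions on subspaces\<close>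

text \<open>The line through \<open>x\<close> in direction \<open>v\<close> stays in
  \<open>V\<close>, so the chain rule works with the derivative within \<open>V\<close>. As ordinary
  derivatives are unique, \<open>f\<close> determines \<open>D\<close> on \<open>V\<close>.\<close>

lemma has_derivative_within_subspace_line:
  fixes f :: "'a::real_normed_vector \<Rightarrow> real"
  assumes "(f has_derivative D) (at x within V)" "subspace V" "x \<in> V" "v \<in> V"
  shows "((\<lambda>s. f (x + s *\<^sub>R v)) has_field_derivative D v) (at 0)"
proof -
  have line: "((\<lambda>s::real. x + s *\<^sub>R v) has_derivative (\<lambda>s. s *\<^sub>R v)) (at 0 within UNIV)"
    by (auto intro!: derivative_eq_intros)
  have "(\<lambda>s::real. x + s *\<^sub>R v) ` UNIV \<subseteq> V"
    using assms by (auto intro: subspace_add subspace_scale)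
  moreover have "(f has_derivative D) (at (x + 0 *\<^sub>R v) within V)"
    using assms(1) by simp
  ultimately have "((\<lambda>s. f (x + s *\<^sub>R v)) has_derivative (\<lambda>s. D (s *\<^sub>R v))) (at 0)"
    by (intro has_derivative_in_compose[OF line]) (rule has_derivative_subset)
  moreover have "(\<lambda>s. D (s *\<^sub>R v)) = (*) (D v)"
    using has_derivative_linear[OF assms(1)] by (auto simp: linear_scale)
  ultimately show ?thesis
    by (simp add: has_field_derivative_def)
qed

lemma has_derivative_cong_openin:
  assumes "(g has_derivative D) (at x within V)" "openin (top_of_set V) U" "x \<in> U"
    and "\<And>y. y \<in> U \<Longrightarrow> f y = g y"
  shows "(f has_derivative D) (at x within V)"
proof -
  obtain d where "d > 0" "ball x d \<inter> V \<subseteq> U"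
    using assms(2,3) by (metis openin_contains_ball)
  then have "g y = f y" if "y \<in> V" "dist y x < d" for y
    using assms(4)[of y] that by (auto simp: dist_commute)
  moreover have "x \<in> V"
    using assms(2,3) openin_imp_subset by blast
  ultimately show ?thesis
    using \<open>d > 0\<close> by (intro has_derivative_transform_within[OF assms(1)])
qed

lemma Ck_on_SucE:
  assumes "Ck_on (Suc k) V U f"
  obtains f' where "\<And>x. x \<in> U \<Longrightarrow> (f has_derivative f' x) (at x within V)"
    and "\<And>v. v \<in> V \<Longrightarrow> Ck_on k V U (\<lambda>x. f' x v)"
proof -
  obtain f' where "\<forall>x\<in>U. (f has_derivative f' x) (at x within V)" "\<forall>v\<in>V. Ck_on k V U (\<lambda>x. f' x v)"
    using assms by (auto simp only: Ck_on.simps)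
  then show thesis
    by (intro that[of f']) (rule bspec; assumption)+
qed

text \<open>No induction is required: on a relatively open set the derivative family of
  \<open>g\<close> serves for \<open>f\<close> as well, so the higher-order conditions
  coincide.\<close>

lemma Ck_on_cong:
  assumes "openin (top_of_set V) U" "Ck_on k V U g" "\<And>x. x \<in> U \<Longrightarrow> f x = g x"
  shows "Ck_on k V U f"
  using assms(2,3)
proof (cases k)
  case 0
  then show ?thesis
    using assms(2,3) continuous_on_cong[of U U f g] by simp
next
  case (Suc k')
  then show ?thesis
    using assms has_derivative_cong_openin[of g _ _ V U f] by fastforce
qed

text \<open>Derivatives chosen on different neighbourhoods agree in directions of \<open>V\<close>,
  so one global choice restricts to all the local ones and the induction passes to each directional
  derivative.\<close>

lemma Ck_on_local:
  assumes "subspace V" "U \<subseteq> V"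
    and "\<And>p. p \<in> U \<Longrightarrow> \<exists>T. openin (top_of_set V) T \<and> p \<in> T \<and> T \<subseteq> U \<and> Ck_on k V T f"
  shows "Ck_on k V U f"
  using assms(3)
proof (induction k arbitrary: f)
  case 0
  show ?case
  proof (simp add: continuous_on_eq_continuous_within, intro ballI)
    fix p assume "p \<in> U"
    then obtain T where T: "openin (top_of_set V) T" "p \<in> T" "T \<subseteq> U" "continuous_on T f"
      using 0[of p] by auto
    then obtain O' where "open O'" "T = V \<inter> O'"
      by (auto simp: openin_open)
    \<comment> \<open>Since \<open>T = V \<inter> O'\<close> and
      \<open>T \<subseteq> U \<subseteq> V\<close>, the sets \<open>T\<close> and \<open>U\<close>
      coincide inside \<open>O'\<close>.\<close>
    then have "at p within T = at p within U"
      using T(2,3) assms(2) by (intro at_within_nhd[of p O']) auto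
    then show "continuous (at p within U) f"
      using T by (metis continuous_on_eq_continuous_within)
  qed
next
  case (Suc k)
  have "\<forall>x\<in>U. \<exists>D. (f has_derivative D) (at x within V)"
    using Suc.prems by (meson Ck_on_SucE)
  then obtain f' where f': "\<And>x. x \<in> U \<Longrightarrow> (f has_derivative f' x) (at x within V)"
    by metis
  have "Ck_on k V U (\<lambda>x. f' x v)" if v: "v \<in> V" for v
  proof (rule Suc.IH)
    fix p assume "p \<in> U"
    then obtain T where T: "openin (top_of_set V) T" "p \<in> T" "T \<subseteq> U" "Ck_on (Suc k) V T f"
      using Suc.prems by blast
    obtain f'' where f'': "\<And>x. x \<in> T \<Longrightarrow> (f has_derivative f'' x) (at x within V)"
      and Ck: "\<And>v. v \<in> V \<Longrightarrow> Ck_on k V T (\<lambda>x. f'' x v)"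
      using Ck_on_SucE[OF T(4)] by metis
    \<comment> \<open>Both values are the derivative at 0 of \<open>s\<close> \<mapsto>
      \<open>f (x + s *\<^sub>R v)\<close>.\<close>
    have "f' x v = f'' x v" if "x \<in> T" for x
    proof -
      have "x \<in> U" "x \<in> V"
        using that T(3) assms(2) by auto
      then show ?thesis
        using has_derivative_within_subspace_line[OF f' assms(1) _ v]
          has_derivative_within_subspace_line[OF f''[OF that] assms(1) _ v] DERIV_unique by blast
    qed
    then have "Ck_on k V T (\<lambda>x. f' x v)"
      by (rule Ck_on_cong[OF T(1) Ck[OF v]])
    with T show "\<exists>T. openin (top_of_set V) T \<and> p \<in> T \<and> T \<subseteq> U \<and> Ck_on k V T (\<lambda>x. f' x v)"
      by blast
  qed
  then show ?case
    unfolding Ck_on.simps using f' by blast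
qed

lemma Ck_on_Suc_imp:
  assumes "U \<subseteq> V" "Ck_on (Suc k) V U f"
  shows "Ck_on k V U f"
  using assms(2)
proof (induction k arbitrary: f)
  case 0
  then obtain f' where "\<And>x. x \<in> U \<Longrightarrow> (f has_derivative f' x) (at x within V)"
    by auto
  then have "\<And>x. x \<in> U \<Longrightarrow> (f has_derivative f' x) (at x within U)"
    using assms(1) has_derivative_subset by blast
  then show ?case
    by (auto intro: has_derivative_continuous_on)
next
  case (Suc k)
  then show ?case
    by (metis Ck_on.simps(2))
qed

section \<open>Constants, sums, products, and the trigonometric functions of the central
  coordinate\<close>

lemma Ck_on_const: "Ck_on k V U (\<lambda>_. c)"
proof (induction k arbitrary: c)
  case (Suc k)
  then show ?case
    unfolding Ck_on.simps by (intro exI[of _ "\<lambda>_ _. 0"]) auto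
qed simp

lemma Ck_on_add:
  "Ck_on k V U f \<Longrightarrow> Ck_on k V U g \<Longrightarrow> Ck_on k V U (\<lambda>x. f x + g x)"
proof (induction k arbitrary: f g)
  case 0
  then show ?case by (auto intro: continuous_on_add)
next
  case (Suc k)
  obtain f' g'
    where "\<And>x. x \<in> U \<Longrightarrow> (f has_derivative f' x) (at x within V)"
      and "\<And>x. x \<in> U \<Longrightarrow> (g has_derivative g' x) (at x within V)"
      and "\<And>v. v \<in> V \<Longrightarrow> Ck_on k V U (\<lambda>x. f' x v)"
      and "\<And>v. v \<in> V \<Longrightarrow> Ck_on k V U (\<lambda>x. g' x v)"
    using Suc.prems unfolding Ck_on.simps by metis
  then show ?case
    using Suc.IH by (auto intro!: exI[of _ "\<lambda>x v. f' x v + g' x v"] has_derivative_add)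
qed

text \<open>The product rule leaves one factor undifferentiated in each term;
  \<open>Ck_on_Suc_imp\<close> lowers its order to that of the induction hypothesis.\<close>

lemma Ck_on_mult:
  assumes "U \<subseteq> V"
  shows "Ck_on k V U f \<Longrightarrow> Ck_on k V U g \<Longrightarrow> Ck_on k V U (\<lambda>x. f x * g x)"
proof (induction k arbitrary: f g)
  case 0
  then show ?case by (auto intro: continuous_on_mult)
next
  case (Suc k)
  obtain f' g'
    where "\<And>x. x \<in> U \<Longrightarrow> (f has_derivative f' x) (at x within V)"
      and "\<And>x. x \<in> U \<Longrightarrow> (g has_derivative g' x) (at x within V)"
      and "\<And>v. v \<in> V \<Longrightarrow> Ck_on k V U (\<lambda>x. f' x v)"
      and "\<And>v. v \<in> V \<Longrightarrow> Ck_on k V U (\<lambda>x. g' x v)"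
    using Suc.prems unfolding Ck_on.simps by metis
  moreover have "Ck_on k V U f" "Ck_on k V U g"
    using Suc.prems assms Ck_on_Suc_imp by blast+
  ultimately show ?case
    using Suc.IH
    by (auto intro!: exI[of _ "\<lambda>x v. f x * g' x v + f' x v * g x"] has_derivative_mult Ck_on_add)
qed

text \<open>Differentiation exchanges the two functions, hence the joint induction. They are the
  coefficients of the differential of \<open>quotient_map_G\<close>.\<close>

lemma Ck_on_sin_cos_snd:
  fixes U V :: "('a::real_normed_vector \<times> real) set"
  assumes "U \<subseteq> V"
  shows "Ck_on k V U (\<lambda>x. sin (snd x)) \<and> Ck_on k V U (\<lambda>x. cos (snd x))"
proof (induction k)
  case 0
  show ?case by (auto intro!: continuous_intros)
next
  case (Suc k)
  have "((\<lambda>x. sin (snd x)) has_derivative (\<lambda>v. snd v * cos (snd x))) (at x within V)"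
    and "((\<lambda>x. cos (snd x)) has_derivative (\<lambda>v. (- snd v) * sin (snd x))) (at x within V)"
    for x :: "'a \<times> real"
    by (auto intro!: derivative_eq_intros)
  moreover have "Ck_on k V U (\<lambda>x. snd v * cos (snd x))"
    and "Ck_on k V U (\<lambda>x. (- snd v) * sin (snd x))" for v :: "'a \<times> real"
    using Suc by (intro Ck_on_mult assms Ck_on_const; simp)+
  ultimately show ?case
    unfolding Ck_on.simps
    by (intro conjI exI[of _ "\<lambda>x v. snd v * cos (snd x)"]
        exI[of _ "\<lambda>x v. (- snd v) * sin (snd x)"] ballI) auto
qed

section \<open>Pulling back along the quotient map\<close>

lemma has_derivative_quotient_map_G:
  fixes x :: "'a::real_normed_vector \<times> real"
  shows "(quotient_map_G has_derivative
     (\<lambda>v. (fst v, Complex (- sin (snd x) * snd v) (cos (snd x) * snd v)))) (at x within V)"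
proof -
  have "((\<lambda>x. (fst x, complex_of_real (cos (snd x)) + \<i> * complex_of_real (sin (snd x))))
      has_derivative (\<lambda>v. (fst v, Complex (- sin (snd x) * snd v) (cos (snd x) * snd v))))
      (at x within V)"
    by (auto intro!: derivative_eq_intros ext simp: complex_eq_iff)
  moreover have "quotient_map_G = (\<lambda>x :: 'a \<times> real. (fst x, complex_of_real (cos (snd x)) + \<i> * complex_of_real (sin (snd x))))"
    by (auto simp: quotient_map_G_def complex_eq_iff)
  ultimately show ?thesis by (simp only:)
qed

lemma continuous_on_quotient_map_G: "continuous_on A quotient_map_G"
  unfolding quotient_map_G_def cis_conv_exp by (intro continuous_intros)

text \<open>The chain rule evaluates \<open>F'\<close> in a direction that varies with the point.
  Expanding it over fixed directions leaves derivatives of \<open>F\<close>, covered by the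
  induction hypothesis, times smooth coefficients.\<close>

lemma Ck_on_comp_quotient_map_G:
  fixes R :: "'a::real_normed_vector set"
  assumes "subspace R" "openin (top_of_set (R \<times> UNIV)) U" "quotient_map_G ` U \<subseteq> U'"
  shows "Ck_on k (R \<times> UNIV) U' F \<Longrightarrow> Ck_on k (R \<times> UNIV) U (F \<circ> quotient_map_G)"
proof (induction k arbitrary: F)
  case 0
  have "continuous_on U quotient_map_G"
    by (rule continuous_on_quotient_map_G)
  then show ?case
    using 0 assms(3) continuous_on_compose continuous_on_subset unfolding Ck_on.simps by metis
next
  case (Suc k)
  then obtain F' where F': "\<And>x. x \<in> U' \<Longrightarrow> (F has_derivative F' x) (at x within R \<times> UNIV)"
    and Ck: "\<And>v. v \<in> R \<times> UNIV \<Longrightarrow> Ck_on k (R \<times> UNIV) U' (\<lambda>x. F' x v)"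
    using Ck_on_SucE[OF Suc.prems] by metis
  define D where "D x v = F' (quotient_map_G x) (fst v, Complex (- sin (snd x) * snd v) (cos (snd x) * snd v))"
    for x v :: "'a \<times> real"
  have sub: "quotient_map_G ` (R \<times> UNIV) \<subseteq> R \<times> UNIV"
    by (auto simp: quotient_map_G_def)
  have "((F \<circ> quotient_map_G) has_derivative D x) (at x within R \<times> UNIV)" if "x \<in> U" for x
    unfolding D_def o_def
    by (rule has_derivative_in_compose[OF has_derivative_quotient_map_G])
       (use F' sub assms(3) that in \<open>blast intro: has_derivative_subset\<close>)
  moreover have "Ck_on k (R \<times> UNIV) U (\<lambda>x. D x v)" if v: "v \<in> R \<times> UNIV" for v
  proof -
    \<comment> \<open>The image of \<open>v\<close> is split along the fixed vectors
      \<open>(fst v, 0)\<close>, \<open>(0, 1)\<close> and \<open>(0, \<i>)\<close>; only the scalar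
      coefficients depend on \<open>x\<close>.\<close>
    have eq: "D x v = F' (quotient_map_G x) (fst v, 0)
        + ((- snd v) * sin (snd x) * F' (quotient_map_G x) (0, 1)
        + snd v * cos (snd x) * F' (quotient_map_G x) (0, \<i>))" if "x \<in> U" for x
    proof -
      have lin: "linear (F' (quotient_map_G x))"
        using F' assms(3) that has_derivative_linear by blast
      have "(fst v, Complex (- sin (snd x) * snd v) (cos (snd x) * snd v))
        = (fst v, 0) + (((- snd v) * sin (snd x)) *\<^sub>R (0, 1) + (snd v * cos (snd x)) *\<^sub>R (0, \<i>))"
        by (auto simp: complex_eq_iff)
      then show ?thesis
        unfolding D_def by (simp only: linear_add[OF lin] linear_scale[OF lin] real_scaleR_def)
    qed
    have "Ck_on k (R \<times> UNIV) U (\<lambda>x. F' (quotient_map_G x) w)" if "w \<in> R \<times> UNIV" for w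
      using Suc.IH[OF Ck[OF that]] by (simp add: o_def)
    then have "Ck_on k (R \<times> UNIV) U (\<lambda>x. F' (quotient_map_G x) (fst v, 0)
        + ((- snd v) * sin (snd x) * F' (quotient_map_G x) (0, 1)
        + snd v * cos (snd x) * F' (quotient_map_G x) (0, \<i>)))"
      using v assms(1) Ck_on_sin_cos_snd[OF openin_imp_subset[OF assms(2)]]
      by (intro Ck_on_add Ck_on_mult Ck_on_const openin_imp_subset[OF assms(2)]) (auto simp: subspace_0)
    then show ?thesis
      using eq by (rule Ck_on_cong[OF assms(2)])
  qed
  ultimately show ?case
    unfolding Ck_on.simps by blast
qed

lemma subspace_range_blinfun: "subspace (range (blinfun_apply P))"
  by (intro linear_subspace_image bounded_linear.linear blinfun.bounded_linear_right subspace_UNIV)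

text \<open>Smoothness on the submanifold only provides local ambient extensions. Each is pulled
  back to an open preimage, and \<open>Ck_on_local\<close> glues the results.\<close>

lemma smooth_on_comp_quotient_map_G:
  assumes "smooth_Gt_P P F"
  shows "smooth_on (G_P P) (G_P P) (F \<circ> quotient_map_G)"
  unfolding smooth_on_def
proof
  fix k
  let ?R = "range (blinfun_apply P)"
  have R: "subspace ?R"
    by (rule subspace_range_blinfun)
  have GP: "G_P P = ?R \<times> UNIV"
    by (simp add: G_P_def)
  show "Ck_on k (G_P P) (G_P P) (F \<circ> quotient_map_G)"
    unfolding GP
  proof (rule Ck_on_local)
    show "subspace (?R \<times> (UNIV :: real set))"
      using R by (simp add: subspace_Times)
    fix p :: "'a \<times> real"
    assume p: "p \<in> ?R \<times> UNIV"
    have "quotient_map_G p \<in> Gt_P P"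
      using p by (auto simp: Gt_P_def quotient_map_G_def)
    then obtain U F' where U: "openin (top_of_set (?R \<times> UNIV)) U" "quotient_map_G p \<in> U"
      and F': "smooth_on (?R \<times> UNIV) U F'" "\<And>x. x \<in> U \<inter> Gt_P P \<Longrightarrow> F x = F' x"
      using assms unfolding smooth_Gt_P_def smooth_on_submanifold_def by metis
    define T :: "('a \<times> real) set" where "T = (?R \<times> UNIV) \<inter> quotient_map_G -` U"
    have "continuous_on (?R \<times> UNIV) quotient_map_G"
      by (rule continuous_on_quotient_map_G)
    moreover have "quotient_map_G \<in> ?R \<times> (UNIV :: real set) \<rightarrow> ?R \<times> (UNIV :: complex set)"
      by (auto simp: quotient_map_G_def)
    ultimately have T: "openin (top_of_set (?R \<times> UNIV)) T"
      unfolding T_def using U(1) continuous_openin_preimage by blast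
    have "Ck_on k (?R \<times> UNIV) T (F' \<circ> quotient_map_G)"
      using Ck_on_comp_quotient_map_G[OF R T, of U k F'] F'(1) by (auto simp: smooth_on_def T_def)
    then have "Ck_on k (?R \<times> UNIV) T (F \<circ> quotient_map_G)"
    proof (rule Ck_on_cong[OF T])
      fix x assume "x \<in> T"
      then show "(F \<circ> quotient_map_G) x = (F' \<circ> quotient_map_G) x"
        using F'(2)[of "quotient_map_G x"] by (auto simp: T_def Gt_P_def quotient_map_G_def)
    qed
    then show "\<exists>T. openin (top_of_set (?R \<times> UNIV)) T \<and> p \<in> T \<and> T \<subseteq> ?R \<times> UNIV \<and>
        Ck_on k (?R \<times> UNIV) T (F \<circ> quotient_map_G)"
      using T p U(2) unfolding T_def by blast
  qed simp
qed

text \<open>Both sides apply \<open>deriv\<close> to the same function of \<open>s\<close>: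
  \<open>cis\<close> turns the sum of central coordinates, including the term \<omega>/2, into the
  product on the circle.\<close>

lemma left_inv_Gt_quotient_map_G:
  "left_inv_Gt \<omega> X f (quotient_map_G g) = left_inv_G \<omega> X (f \<circ> quotient_map_G) g"
  unfolding left_inv_Gt_def left_inv_G_def
  by (simp add: mult_Gt_def mult_G_def quotient_map_G_def cis_mult o_def)

section \<open>Boundedness\<close>

text \<open>Outside \<open>K\<close> the function vanishes; over \<open>K\<close> a shift by periods
  reduces to a compact set, where continuity bounds it.\<close>

lemma bounded_periodic_compact_support:
  fixes h :: "'a::real_normed_vector \<times> real \<Rightarrow> real"
  assumes cont: "continuous_on (R \<times> UNIV) h" and "closed R" "compact K"
    and supp: "\<And>w c. w \<in> R \<Longrightarrow> w \<notin> K \<Longrightarrow> h (w, c) = 0"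
    and per: "\<And>w c n. w \<in> R \<Longrightarrow> h (w, c + 2 * pi * of_int n) = h (w, c)"
  obtains M where "M \<ge> 0" "\<And>x. x \<in> R \<times> UNIV \<Longrightarrow> \<bar>h x\<bar> \<le> M"
proof -
  have "compact ((K \<inter> R) \<times> {0..2 * pi})"
    using assms by (intro compact_Times) auto
  moreover have "continuous_on ((K \<inter> R) \<times> {0..2 * pi}) h"
    by (rule continuous_on_subset[OF cont]) auto
  ultimately have "bounded (h ` ((K \<inter> R) \<times> {0..2 * pi}))"
    using compact_continuous_image compact_imp_bounded by blast
  then obtain M where M: "M > 0" "\<And>x. x \<in> (K \<inter> R) \<times> {0..2 * pi} \<Longrightarrow> \<bar>h x\<bar> \<le> M"
    unfolding bounded_pos by auto
  have "\<bar>h x\<bar> \<le> M" if "x \<in> R \<times> UNIV" for x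
  proof (cases "fst x \<in> K")
    case True
    \<comment> \<open>Subtracting the whole periods leaves 2 pi times a fractional part, a number in
      the fundamental interval.\<close>
    define n where "n = - \<lfloor>snd x / (2 * pi)\<rfloor>"
    have "snd x + 2 * pi * of_int n = 2 * pi * frac (snd x / (2 * pi))"
      by (simp add: n_def frac_def field_simps)
    then have "snd x + 2 * pi * of_int n \<in> {0..2 * pi}"
      using frac_ge_0[of "snd x / (2 * pi)"] frac_lt_1[of "snd x / (2 * pi)"]
      by (simp add: mult_left_le)
    then show ?thesis
      using M(2)[of "(fst x, snd x + 2 * pi * of_int n)"] per[of "fst x" "snd x" n] that True
      by (auto simp: mem_Times_iff)
  next
    case False
    then show ?thesis
      using supp[of "fst x" "snd x"] M(1) that by (auto simp: mem_Times_iff)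
  qed
  then show thesis
    using that M(1) by (meson less_imp_le)
qed

text \<open>As the derivative of \<open>h\<close> along a line, \<open>D x v\<close> inherits
  periodicity and vanishing outside \<open>K\<close>, so the previous bound applies to it.\<close>

lemma bounded_directional_derivative:
  fixes h :: "'a::real_normed_vector \<times> real \<Rightarrow> real"
  assumes R: "subspace R" "closed R" and K: "compact K"
    and D: "\<And>x. x \<in> R \<times> UNIV \<Longrightarrow> (h has_derivative D x) (at x within R \<times> UNIV)"
    and v: "v \<in> R \<times> UNIV"
    and cont: "continuous_on (R \<times> UNIV) (\<lambda>x. D x v)"
    and supp: "\<And>w c. w \<in> R \<Longrightarrow> w \<notin> K \<Longrightarrow> h (w, c) = 0"
    and per: "\<And>w c n. w \<in> R \<Longrightarrow> h (w, c + 2 * pi * of_int n) = h (w, c)"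
  obtains M where "M \<ge> 0" "\<And>x. x \<in> R \<times> UNIV \<Longrightarrow> \<bar>D x v\<bar> \<le> M"
proof (rule bounded_periodic_compact_support[OF cont R(2) K])
  have V: "subspace (R \<times> (UNIV :: real set))"
    using R(1) by (simp add: subspace_Times)
  have line: "((\<lambda>s. h (x + s *\<^sub>R v)) has_field_derivative D x v) (at 0)" if "x \<in> R \<times> UNIV" for x
    using has_derivative_within_subspace_line[OF D V _ v] that by blast
  have inR: "w + s *\<^sub>R fst v \<in> R" if "w \<in> R" for w s
    using R(1) v that by (auto intro!: subspace_add subspace_scale)
  fix w c assume w: "w \<in> R"
  show "D (w, c + 2 * pi * of_int n) v = D (w, c) v" for n
  proof -
    have "h ((w, c + 2 * pi * of_int n) + s *\<^sub>R v) = h ((w, c) + s *\<^sub>R v)" for s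
      using per[of "w + s *\<^sub>R fst v" "c + s * snd v" n] inR[OF w]
      by (cases v) (simp add: algebra_simps)
    then show ?thesis
      using line[of "(w, c)"] line[of "(w, c + 2 * pi * of_int n)"] w DERIV_unique by force
  qed
  assume "w \<notin> K"
  moreover have "((\<lambda>s. w + s *\<^sub>R fst v) \<longlongrightarrow> w + 0 *\<^sub>R fst v) (at 0)"
    by (intro tendsto_intros)
  \<comment> \<open>The complement of the compact set \<open>K\<close> is open, so a line starting
    outside \<open>K\<close> stays outside for small \<open>s\<close>.\<close>
  ultimately have "\<forall>\<^sub>F s in at 0. w + s *\<^sub>R fst v \<in> - K"
    using topological_tendstoD[of _ _ _ "- K"] compact_imp_closed[OF K] by fastforce
  then have "\<forall>\<^sub>F s in at 0. h ((w, c) + s *\<^sub>R v) = 0"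
    by (rule eventually_mono) (use supp inR[OF w] in \<open>cases v; auto\<close>)
  \<comment> \<open>The filter \<open>at 0\<close> omits the point 0 itself, where the value is
    needed too.\<close>
  moreover have "h ((w, c) + 0 *\<^sub>R v) = 0"
    using \<open>w \<notin> K\<close> w supp by simp
  ultimately have "((\<lambda>s. h ((w, c) + s *\<^sub>R v)) has_field_derivative 0) (at 0)"
    by (subst has_field_derivative_cong_eventually[where g = "\<lambda>_. 0"]) auto
  then show "D (w, c) v = 0"
    using line[of "(w, c)"] w DERIV_unique by auto
qed (use that in auto)

lemma smooth_on_has_continuous_derivative:
  assumes "smooth_on V U f"
  obtains D where "\<And>x. x \<in> U \<Longrightarrow> (f has_derivative D x) (at x within V)"
    and "\<And>v. v \<in> V \<Longrightarrow> continuous_on U (\<lambda>x. D x v)"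
proof -
  have "Ck_on (Suc 0) V U f"
    using assms unfolding smooth_on_def by blast
  then show thesis
    using Ck_on_SucE that by (metis Ck_on.simps(1))
qed

section \<open>Left-invariant derivatives of cylinder functions and their growth\<close>

text \<open>Linearity of \<omega> in its second argument makes the projected curve a straight line.
  The central coefficient involves the unprojected \<open>fst g\<close>, which is the source of the
  linear growth.\<close>

lemma left_inv_G_cylinder:
  fixes \<omega> :: "'w::real_normed_vector \<Rightarrow> 'w \<Rightarrow> real"
  assumes \<omega>: "bounded_bilinear \<omega>"
    and D: "(\<Phi> has_derivative D) (at (proj_P P g) within G_P P)"
  shows "left_inv_G \<omega> X (\<Phi> \<circ> proj_P P) g =
    D (blinfun_apply P (fst X), 0) + (snd X + \<omega> (fst g) (fst X) / 2) * D (0, 1)"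
proof -
  let ?c = "snd X + \<omega> (fst g) (fst X) / 2"
  let ?v = "(blinfun_apply P (fst X), ?c)"
  have R: "subspace (range (blinfun_apply P))"
    by (rule subspace_range_blinfun)
  then have "subspace (G_P P)"
    unfolding G_P_def by (simp add: subspace_Times)
  then have "((\<lambda>s. \<Phi> (proj_P P g + s *\<^sub>R ?v)) has_field_derivative D ?v) (at 0)"
    using has_derivative_within_subspace_line[OF D] by (auto simp: proj_P_def G_P_def)
  moreover have "\<Phi> (proj_P P g + s *\<^sub>R ?v) = (\<Phi> \<circ> proj_P P) (mult_G \<omega> g (s *\<^sub>R fst X, s * snd X))" for s
    using bounded_bilinear.scaleR_right[OF \<omega>]
    by (simp add: proj_P_def mult_G_def blinfun.add_right blinfun.scaleR_right algebra_simps)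
  ultimately have "left_inv_G \<omega> X (\<Phi> \<circ> proj_P P) g = D ?v"
    unfolding left_inv_G_def using DERIV_imp_deriv by simp
  also have "?v = (blinfun_apply P (fst X), 0) + ?c *\<^sub>R (0, 1)"
    by simp
  also have "D \<dots> = D (blinfun_apply P (fst X), 0) + ?c * D (0, 1)"
    by (simp only: linear_add linear_scale has_derivative_linear[OF D] real_scaleR_def)
  finally show ?thesis .
qed

lemma FC_Gt_comp_quotient_map_G:
  assumes \<omega>: "bounded_bilinear \<omega>" and f: "f \<in> FC_Gt \<mu> \<omega>"
  shows "f \<circ> quotient_map_G \<in> class_A \<mu> \<omega>"
proof -
  obtain P F where P: "P \<in> Proj_W \<mu> \<omega>" and F: "smooth_Gt_P P F"
    and comp: "compact (closure {x \<in> Gt_P P. F x \<noteq> 0})"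
    and fF: "\<And>g. g \<in> carrier_Gt \<Longrightarrow> f g = F (proj_P P g)"
    using f by (auto simp: FC_Gt_def)
  define \<Phi> :: "'a \<times> real \<Rightarrow> real" where "\<Phi> = F \<circ> quotient_map_G"
  have "smooth_on (G_P P) (G_P P) \<Phi>"
    unfolding \<Phi>_def by (rule smooth_on_comp_quotient_map_G[OF F])
  moreover have eq: "f \<circ> quotient_map_G = \<Phi> \<circ> proj_P P"
    by (auto simp: \<Phi>_def fF carrier_Gt_def quotient_map_G_def proj_P_def)
  ultimately have cyl: "f \<circ> quotient_map_G \<in> cyl_G \<mu> \<omega>"
    using P unfolding cyl_G_def by blast
  let ?R = "range (blinfun_apply P)"
  \<comment> \<open>Projecting the support to \<open>W\<close> yields a compact set outside which
    \<open>F\<close> vanishes for every central coordinate.\<close>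
  define K where "K = fst ` closure {x \<in> Gt_P P. F x \<noteq> 0}"
  have K: "compact K"
    unfolding K_def by (intro compact_continuous_image continuous_intros comp)
  have R: "subspace ?R"
    by (rule subspace_range_blinfun)
  have "P o\<^sub>L P = P"
    using P by (simp add: Proj_W_def)
  \<comment> \<open>The range of a continuous idempotent is its fixed-point set, hence
    closed.\<close>
  then have "?R = {x. blinfun_apply P x = x}"
    by (auto simp: image_iff) (metis blinfun_apply_blinfun_compose)+
  then have "closed ?R"
    by (simp add: closed_Collect_eq continuous_intros)
  obtain D where D: "\<And>x. x \<in> G_P P \<Longrightarrow> (\<Phi> has_derivative D x) (at x within G_P P)"
    and contD: "\<And>v. v \<in> G_P P \<Longrightarrow> continuous_on (G_P P) (\<lambda>x. D x v)"
    using smooth_on_has_continuous_derivative[OF \<open>smooth_on (G_P P) (G_P P) \<Phi>\<close>] by blast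
  have cont: "continuous_on (G_P P) \<Phi>"
    using D by (rule has_derivative_continuous_on)
  have supp: "\<Phi> (w, c) = 0" if "w \<in> ?R" "w \<notin> K" for w c
  proof (rule ccontr)
    assume "\<Phi> (w, c) \<noteq> 0"
    then have "(w, cis c) \<in> {x \<in> Gt_P P. F x \<noteq> 0}"
      using that by (auto simp: \<Phi>_def quotient_map_G_def Gt_P_def)
    then show False
      using that(2) closure_subset fst_conv image_eqI unfolding K_def by (metis (no_types) subsetD)
  qed
  have per: "\<Phi> (w, c + 2 * pi * of_int n) = \<Phi> (w, c)" for w c n
    by (simp add: \<Phi>_def quotient_map_G_def flip: cis_mult)
  note bdd = bounded_directional_derivative[OF R \<open>closed ?R\<close> K D[unfolded G_P_def] _
      contD[unfolded G_P_def] supp per]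
  obtain M where M: "\<And>x. x \<in> ?R \<times> UNIV \<Longrightarrow> \<bar>\<Phi> x\<bar> \<le> M"
    using bounded_periodic_compact_support[OF cont[unfolded G_P_def] \<open>closed ?R\<close> K supp per] by metis
  then have "poly_bounded_G (f \<circ> quotient_map_G)"
    unfolding poly_bounded_G_def eq by (intro exI[of _ M] exI[of _ 0]) (auto simp: proj_P_def)
  moreover have "poly_bounded_G (left_inv_G \<omega> X (f \<circ> quotient_map_G))" for X
  proof -
    obtain M1 where M1: "M1 \<ge> 0" "\<And>x. x \<in> ?R \<times> UNIV \<Longrightarrow> \<bar>D x (blinfun_apply P (fst X), 0)\<bar> \<le> M1"
      by (rule bdd[of "(blinfun_apply P (fst X), 0)"]) auto
    obtain M2 where M2: "M2 \<ge> 0" "\<And>x. x \<in> ?R \<times> UNIV \<Longrightarrow> \<bar>D x (0, 1)\<bar> \<le> M2"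
      by (rule bdd[of "(0, 1)"]) (use subspace_0[OF R] in auto)
    obtain k where k: "k \<ge> 0" "\<And>a b. \<bar>\<omega> a b\<bar> \<le> norm a * norm b * k"
      using bounded_bilinear.nonneg_bounded[OF \<omega>] by auto
    let ?a = "\<bar>snd X\<bar>" and ?b = "norm (fst X) * k / 2"
    \<comment> \<open>\<open>M1\<close> bounds the derivative in the projected direction and
      \<open>M2\<close> the central one, whose coefficient is at most
      \<open>?a + norm (fst g) * ?b\<close>. Degree one then suffices because
      \<open>norm (fst g)\<close> is at most \<open>norm g\<close>.\<close>
    have "\<bar>left_inv_G \<omega> X (f \<circ> quotient_map_G) g\<bar> \<le> (M1 + (?a + ?b) * M2) * (1 + norm g) ^ 1" for g
    proof -
      have g: "proj_P P g \<in> ?R \<times> UNIV"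
        by (simp add: proj_P_def)
      have "\<bar>snd X + \<omega> (fst g) (fst X) / 2\<bar> \<le> ?a + norm (fst g) * ?b"
        using k(2)[of "fst g" "fst X"] by (simp add: abs_le_iff) argo
      also have "\<dots> \<le> (?a + ?b) * (1 + norm g)"
        unfolding distrib_right mult.commute[of "norm (fst g)"] using norm_fst_le[of "fst g" "snd g"] k(1)
        by (intro add_mono mult_left_mono) (auto simp: algebra_simps)
      finally have "\<bar>snd X + \<omega> (fst g) (fst X) / 2\<bar> * \<bar>D (proj_P P g) (0, 1)\<bar>
          \<le> (?a + ?b) * (1 + norm g) * M2"
        using M2(2)[OF g] by (intro mult_mono) (auto simp: k(1))
      moreover have "\<bar>D (proj_P P g) (blinfun_apply P (fst X), 0)\<bar> \<le> M1 * (1 + norm g)"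
        using M1(2)[OF g] M1(1) by (simp add: algebra_simps add_increasing2)
      moreover have "left_inv_G \<omega> X (f \<circ> quotient_map_G) g =
          D (proj_P P g) (blinfun_apply P (fst X), 0)
          + (snd X + \<omega> (fst g) (fst X) / 2) * D (proj_P P g) (0, 1)"
        unfolding eq using left_inv_G_cylinder[OF \<omega> D] g by (auto simp: G_P_def)
      ultimately show ?thesis
        by (simp only: abs_mult[symmetric] distrib_right power_one_right) argo
    qed
    then show ?thesis
      unfolding poly_bounded_G_def by blast
  qed
  ultimately show ?thesis
    using cyl by (auto simp: class_A_def)
qed

section \<open>Transfer of gradients and sub-Laplacians\<close>

theorem proposition4p15:
  fixes \<mu> :: "'w::{banach, second_countable_topology} measure"
    and \<omega> :: "'w \<Rightarrow> 'w \<Rightarrow> real"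
    and f :: "'w \<times> complex \<Rightarrow> real"
  assumes "nondegenerate_gaussian \<mu>"
    and "nondegenerate_skew_form \<omega>"
    and "span {\<omega> u v | u v. u \<in> cm_space \<mu> \<and> v \<in> cm_space \<mu>} = UNIV"
    and "f \<in> FC_Gt \<mu> \<omega>"
  shows "((\<lambda>g. cm_inner \<mu> (grad_Gt \<mu> \<omega> f g) (grad_Gt \<mu> \<omega> f g)) \<circ> quotient_map_G =
           (\<lambda>g. cm_inner \<mu> (grad_G \<mu> \<omega> (f \<circ> quotient_map_G) g)
                            (grad_G \<mu> \<omega> (f \<circ> quotient_map_G) g))) \<and>
         (subLaplacian_Gt \<mu> \<omega> f \<circ> quotient_map_G = subLaplacian_G \<mu> \<omega> (f \<circ> quotient_map_G))"
proof -
  have \<omega>: "bounded_bilinear \<omega>"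
    using assms(2) by (simp add: nondegenerate_skew_form_def)
  note left_inv = left_inv_Gt_quotient_map_G
  have A: "f \<circ> quotient_map_G \<in> class_A \<mu> \<omega>"
    using FC_Gt_comp_quotient_map_G[OF \<omega> assms(4)] .
  then have cyl: "f \<circ> quotient_map_G \<in> cyl_G \<mu> \<omega>"
    by (simp add: class_A_def)
  have cylt: "f \<in> cyl_Gt \<mu> \<omega>"
    using assms(4) unfolding FC_Gt_def cyl_Gt_def by blast
  \<comment> \<open>Once both functions lie in their domains, the two \<open>THE\<close>
    descriptions have the same defining condition, so they denote the same vector.\<close>
  have "grad_Gt \<mu> \<omega> f (quotient_map_G g) = grad_G \<mu> \<omega> (f \<circ> quotient_map_G) g" for g
    using A assms(4) by (simp add: grad_Gt_def grad_G_def left_inv)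
  \<comment> \<open>The second derivative differentiates a function, so the pointwise identity is
    lifted to functions before being applied twice.\<close>
  moreover have "left_inv_Gt \<omega> X f \<circ> quotient_map_G = left_inv_G \<omega> X (f \<circ> quotient_map_G)" for X
    by (auto simp: left_inv)
  then have "subLaplacian_Gt \<mu> \<omega> f (quotient_map_G g) = subLaplacian_G \<mu> \<omega> (f \<circ> quotient_map_G) g" for g
    using cyl cylt by (simp add: subLaplacian_Gt_def subLaplacian_G_def left_inv)
  ultimately show ?thesis
    by auto
qed

end
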